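(* Let \[I_2=\begin{pmatrix}1&0\\0&1\end{pmatrix},\quad U=\begin{pmatrix}\frac12&\frac{\sqrt3}{2}\\\frac{\sqrt3}{2}&-\frac12\end{pmatrix},\quad V=\begin{pmatrix}\frac12&-\frac{\sqrt3}{2}\\\frac{\sqrt3}{2}&\frac12\end{pmatrix},\] and let $D$ be a diagonal operator on $\ell^2(\mathbb{Z})$ with $\|D\|\le 1$ and $\mathbb{T}\subset\sigma(D)$. On $\mathbb{C}^2\oplus\ell^2(\mathbb{Z})$ let $\tilde T_1=I_2\oplus D$, $\tilde T_2=U\oplus D$, $\tilde T_3=V\oplus D$, and let $\hat T_1=\tilde T_1\otimes I\otimes I$, $\hat T_2=I\otimes\tilde T_2\otimes I$, $\hat T_3=I\otimes I\otimes\tilde T_3$. Let $S_1=\hat T_1\oplus I_2$, $S_2=\hat T_2\oplus U$, $S_3=\hat T_3\oplus V$, acting on the Hilbert space $\mathbb{K}=(\mathbb{C}^2\oplus\ell^2(\mathbb{Z}))^{\otimes 3}\oplus\mathbb{C}^2$. Then the linear map $S:\ell^1(3)\to\mathcal{B}(\mathbb{K})$, $S(z_1,z_2,z_3)=z_1S_1+z_2S_2+z_3S_3$, is an isometry, and the operator space structure it induces on $\ell^1(3)$ is different from the MIN structure; that is, $S$ is not a complete isometry from $\mathrm{MIN}(\ell^1(3))$ onto its image.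
   Context: $\ell^1(3)$ is $\mathbb{C}^3$ with the norm $\sum|z_i|$; $\mathbb{T}$ is the unit circle and $\sigma$ denotes spectrum. The MIN operator space structure on a normed space $W$ is given, for $(v_{ij})\in M_k(W)$, by $\|(v_{ij})\|_{MIN}=\sup\{\|(g(v_{ij}))\|_{M_k}: g\in W^*,\ \|g\|\le 1\}$. The operator space structure induced by an isometry $S:W\to\mathcal{B}(\mathbb{K})$ has matrix norms $\|(v_{ij})\|_k=\|(S(v_{ij}))\|_{\mathcal{B}(\mathbb{K}^k)}$. A linear map is a complete isometry if all its amplifications $S\otimes I_k$ are isometries. *)

theory Defs
  imports "HOL-Analysis.Analysis"
begin

section \<open>Complex normed spaces and bounded complex-linear maps\<close>

class complex_normed_vector = real_normed_vector +
  fixes scaleC :: "complex \<Rightarrow> 'a \<Rightarrow> 'a" (infixr "*\<^sub>C" 75)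
  assumes scaleC_add_right: "c *\<^sub>C (x + y) = c *\<^sub>C x + c *\<^sub>C y"
    and scaleC_add_left: "(c + d) *\<^sub>C x = c *\<^sub>C x + d *\<^sub>C x"
    and scaleC_scaleC: "c *\<^sub>C d *\<^sub>C x = (c * d) *\<^sub>C x"
    and scaleR_scaleC: "r *\<^sub>R x = complex_of_real r *\<^sub>C x"
    and norm_scaleC: "norm (c *\<^sub>C x) = cmod c * norm x"

instantiation complex :: complex_normed_vector
begin
definition scaleC_complex :: "complex \<Rightarrow> complex \<Rightarrow> complex" where
  "scaleC_complex c x = c * x"
instance
  by standard (auto simp: scaleC_complex_def algebra_simps norm_mult scaleR_conv_of_real)
end

definition bounded_clinear ::
    "('a::complex_normed_vector \<Rightarrow> 'b::complex_normed_vector) \<Rightarrow> bool" where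
  "bounded_clinear f \<longleftrightarrow> bounded_linear f \<and> (\<forall>c x. f (c *\<^sub>C x) = c *\<^sub>C f x)"

definition spectrum :: "('a::complex_normed_vector \<Rightarrow> 'a) \<Rightarrow> complex set" where
  "spectrum T = {z. \<not> (\<exists>R. bounded_clinear R \<and>
     R \<circ> (\<lambda>x. T x - z *\<^sub>C x) = id \<and> (\<lambda>x. T x - z *\<^sub>C x) \<circ> R = id)}"

lemma bounded_clinearI:
  assumes "\<And>x y. f (x + y) = f x + f y" "\<And>c x. f (c *\<^sub>C x) = c *\<^sub>C f x"
    and "\<And>x. norm (f x) \<le> K * norm x"
  shows "bounded_clinear f"
  unfolding bounded_clinear_def
proof (intro conjI allI)
  show "bounded_linear f"
    by (rule bounded_linear_intro[where K = K])
      (use assms in \<open>auto simp: scaleR_scaleC mult.commute\<close>)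
qed (rule assms)

lemma bounded_clinear_compose:
  assumes "bounded_clinear f" "bounded_clinear g"
  shows "bounded_clinear (f \<circ> g)"
  using assms by (auto simp: bounded_clinear_def o_def intro: bounded_linear_compose)


section \<open>The Hilbert space of square-summable families\<close>

typedef 'a ell2 = "{x :: 'a \<Rightarrow> complex. (\<lambda>i. (cmod (x i))\<^sup>2) summable_on UNIV}"
  morphisms coord Ell2
  by (rule exI[of _ "\<lambda>_. 0"]) simp

lemma Ell2_bound:
  assumes "\<And>F. finite F \<Longrightarrow> (\<Sum>i\<in>F. (cmod (f i))\<^sup>2) \<le> B"
  shows "coord (Ell2 f) = f"
proof -
  have "(\<lambda>i. (cmod (f i))\<^sup>2) summable_on UNIV"
    by (rule nonneg_bdd_above_summable_on) (auto intro!: bdd_aboveI[of _ B] assms)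
  then show ?thesis by (simp add: Ell2_inverse)
qed

lemma ell2_eqI: "(\<And>i. coord x i = coord y i) \<Longrightarrow> x = y"
  by (simp add: coord_inject[symmetric] fun_eq_iff)

definition ell2_norm :: "'a ell2 \<Rightarrow> real" where
  "ell2_norm x = sqrt (\<Sum>\<^sub>\<infinity>i. (cmod (coord x i))\<^sup>2)"

lemma coord_summable: "(\<lambda>i. (cmod (coord x i))\<^sup>2) summable_on UNIV"
  using coord[of x] by simp

lemma ell2_norm_nonneg: "ell2_norm x \<ge> 0"
  by (simp add: ell2_norm_def infsum_nonneg)

lemma ell2_norm_sq: "(ell2_norm x)\<^sup>2 = (\<Sum>\<^sub>\<infinity>i. (cmod (coord x i))\<^sup>2)"
  by (simp add: ell2_norm_def infsum_nonneg)

lemma ell2_norm_ge: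
  assumes "finite F"
  shows "(\<Sum>i\<in>F. (cmod (coord x i))\<^sup>2) \<le> (ell2_norm x)\<^sup>2"
  unfolding ell2_norm_sq by (rule finite_sum_le_infsum) (use assms coord_summable in auto)

lemma L2_set_le_ell2_norm:
  assumes "finite F"
  shows "L2_set (\<lambda>i. cmod (coord x i)) F \<le> ell2_norm x"
  unfolding L2_set_def using ell2_norm_ge[OF assms, of x] ell2_norm_nonneg
  by (rule real_le_lsqrt[rotated])

lemma ell2_norm_le:
  assumes "\<And>F. finite F \<Longrightarrow> (\<Sum>i\<in>F. (cmod (coord x i))\<^sup>2) \<le> b\<^sup>2" "b \<ge> 0"
  shows "ell2_norm x \<le> b"
proof -
  have "(ell2_norm x)\<^sup>2 \<le> b\<^sup>2"
    unfolding ell2_norm_sq by (rule infsum_le_finite_sums) (use assms coord_summable in auto)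
  then show ?thesis using assms(2) by (rule power2_le_imp_le)
qed

instantiation ell2 :: (type) complex_normed_vector
begin

definition zero_ell2 :: "'a ell2" where "0 = Ell2 (\<lambda>_. 0)"
definition plus_ell2 :: "'a ell2 \<Rightarrow> 'a ell2 \<Rightarrow> 'a ell2" where
  "x + y = Ell2 (\<lambda>i. coord x i + coord y i)"
definition minus_ell2 :: "'a ell2 \<Rightarrow> 'a ell2 \<Rightarrow> 'a ell2" where
  "x - y = Ell2 (\<lambda>i. coord x i - coord y i)"
definition uminus_ell2 :: "'a ell2 \<Rightarrow> 'a ell2" where
  "- x = Ell2 (\<lambda>i. - coord x i)"
definition scaleR_ell2 :: "real \<Rightarrow> 'a ell2 \<Rightarrow> 'a ell2" where
  "r *\<^sub>R x = Ell2 (\<lambda>i. complex_of_real r * coord x i)"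
definition scaleC_ell2 :: "complex \<Rightarrow> 'a ell2 \<Rightarrow> 'a ell2" where
  "c *\<^sub>C x = Ell2 (\<lambda>i. c * coord x i)"
definition norm_ell2 :: "'a ell2 \<Rightarrow> real" where "norm x = ell2_norm x"
definition dist_ell2 :: "'a ell2 \<Rightarrow> 'a ell2 \<Rightarrow> real" where "dist_ell2 x y = norm (x - y)"
definition sgn_ell2 :: "'a ell2 \<Rightarrow> 'a ell2" where "sgn_ell2 x = inverse (norm x) *\<^sub>R x"
definition uniformity_ell2 :: "('a ell2 \<times> 'a ell2) filter" where
  "uniformity_ell2 = (INF e\<in>{0<..}. principal {(x, y). dist x y < e})"
definition open_ell2 :: "'a ell2 set \<Rightarrow> bool" where
  "open_ell2 U \<longleftrightarrow> (\<forall>x\<in>U. \<forall>\<^sub>F (x', y) in uniformity. x' = x \<longrightarrow> y \<in> U)"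

lemma coord_add_bound:
  assumes "finite F"
  shows "(\<Sum>i\<in>F. (cmod (coord x i + coord y i))\<^sup>2) \<le> (ell2_norm x + ell2_norm y)\<^sup>2"
proof -
  have "L2_set (\<lambda>i. cmod (coord x i + coord y i)) F
      \<le> L2_set (\<lambda>i. cmod (coord x i) + cmod (coord y i)) F"
    by (rule L2_set_mono) (auto intro: norm_triangle_ineq)
  also have "\<dots> \<le> L2_set (\<lambda>i. cmod (coord x i)) F + L2_set (\<lambda>i. cmod (coord y i)) F"
    by (rule L2_set_triangle_ineq)
  also have "\<dots> \<le> ell2_norm x + ell2_norm y"
    by (intro add_mono L2_set_le_ell2_norm assms)
  finally have "L2_set (\<lambda>i. cmod (coord x i + coord y i)) F \<le> ell2_norm x + ell2_norm y" .
  then have "(L2_set (\<lambda>i. cmod (coord x i + coord y i)) F)\<^sup>2 \<le> (ell2_norm x + ell2_norm y)\<^sup>2"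
    by (rule power_mono) simp
  then show ?thesis by (simp add: L2_set_def sum_nonneg)
qed

lemma coord_scale_bound:
  assumes "finite F"
  shows "(\<Sum>i\<in>F. (cmod (c * coord x i))\<^sup>2) \<le> (cmod c * ell2_norm x)\<^sup>2"
  using mult_left_mono[OF ell2_norm_ge[OF assms, of x], of "(cmod c)\<^sup>2"]
  by (simp add: norm_mult power_mult_distrib sum_distrib_left)

lemma coord_zero [simp]: "coord 0 i = 0"
  unfolding zero_ell2_def by (subst Ell2_bound[where B = 0]) auto

lemma coord_add [simp]: "coord (x + y) i = coord x i + coord y i"
  unfolding plus_ell2_def by (subst Ell2_bound) (rule coord_add_bound, auto)

lemma coord_scaleC [simp]: "coord (c *\<^sub>C x) i = c * coord x i"
  unfolding scaleC_ell2_def by (subst Ell2_bound) (rule coord_scale_bound, auto)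

lemma coord_scaleR [simp]: "coord (r *\<^sub>R x) i = complex_of_real r * coord x i"
  unfolding scaleR_ell2_def by (subst Ell2_bound) (rule coord_scale_bound, auto)

lemma coord_uminus [simp]: "coord (- x) i = - coord x i"
  using coord_scaleC[of "-1" x i] by (simp add: uminus_ell2_def scaleC_ell2_def)

lemma coord_minus [simp]: "coord (x - y) i = coord x i - coord y i"
proof -
  have "x - y = x + - y" by (simp add: minus_ell2_def plus_ell2_def)
  then show ?thesis by simp
qed

lemma ell2_norm_scale: "ell2_norm (c *\<^sub>C x) = cmod c * ell2_norm x"
proof -
  have "(ell2_norm (c *\<^sub>C x))\<^sup>2 = (cmod c * ell2_norm x)\<^sup>2"
    by (simp add: power_mult_distrib ell2_norm_sq norm_mult infsum_cmult_right')
  then show ?thesis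
    by (simp add: ell2_norm_nonneg power2_eq_iff_nonneg)
qed

instance
proof
  fix x y z :: "'a ell2" and r s :: real and c d :: complex and U :: "'a ell2 set"
  show "x + y + z = x + (y + z)" "x + y = y + x" "0 + x = x" "- x + x = 0" "x - y = x + - y"
    by (auto intro!: ell2_eqI)
  show "r *\<^sub>R (x + y) = r *\<^sub>R x + r *\<^sub>R y" "(r + s) *\<^sub>R x = r *\<^sub>R x + s *\<^sub>R x"
    "r *\<^sub>R s *\<^sub>R x = (r * s) *\<^sub>R x" "1 *\<^sub>R x = x"
    "c *\<^sub>C (x + y) = c *\<^sub>C x + c *\<^sub>C y" "(c + d) *\<^sub>C x = c *\<^sub>C x + d *\<^sub>C x"
    "c *\<^sub>C d *\<^sub>C x = (c * d) *\<^sub>C x" "r *\<^sub>R x = complex_of_real r *\<^sub>C x"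
    by (auto intro!: ell2_eqI simp: algebra_simps)
  then show "norm (r *\<^sub>R x) = \<bar>r\<bar> * norm x"
    by (simp add: norm_ell2_def ell2_norm_scale)
  show "norm (c *\<^sub>C x) = cmod c * norm x"
    by (simp add: norm_ell2_def ell2_norm_scale)
  show "norm (x + y) \<le> norm x + norm y"
    unfolding norm_ell2_def
    by (rule ell2_norm_le) (auto intro: coord_add_bound simp: ell2_norm_nonneg)
  show "norm x = 0 \<longleftrightarrow> x = 0"
  proof
    assume *: "norm x = 0"
    show "x = 0"
    proof (rule ell2_eqI)
      fix i show "coord x i = coord 0 i"
        using ell2_norm_ge[of "{i}" x] * by (simp add: norm_ell2_def)
    qed
  next
    assume "x = 0" then show "norm x = 0"
      by (simp add: norm_ell2_def ell2_norm_def)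
  qed
qed (rule dist_ell2_def sgn_ell2_def uniformity_ell2_def open_ell2_def)+

end


section \<open>Operators on \<open>\<ell>\<^sup>2\<close>: matrices, diagonal operators, direct sums\<close>

text \<open>
  \<open>\<complex>\<^sup>n\<close> with its Hilbert space norm is \<open>'n ell2\<close> for a finite type \<open>'n\<close>.
\<close>

definition mat_op :: "complex^'n^'n \<Rightarrow> 'n::finite ell2 \<Rightarrow> 'n ell2" where
  "mat_op M x = Ell2 (\<lambda>i. (M *v (\<chi> j. coord x j)) $ i)"

definition diagonal_op :: "('a ell2 \<Rightarrow> 'a ell2) \<Rightarrow> bool" where
  "diagonal_op T \<longleftrightarrow> (\<exists>d. \<forall>x i. coord (T x) i = d i * coord x i)"

text \<open>The Hilbert direct sum of \<open>'a ell2\<close> and \<open>'b ell2\<close> is \<open>('a + 'b) ell2\<close>.\<close>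

definition dsum_vec :: "'a ell2 \<Rightarrow> 'b ell2 \<Rightarrow> ('a + 'b) ell2" where
  "dsum_vec x y = Ell2 (case_sum (coord x) (coord y))"

definition inl_part :: "('a + 'b) ell2 \<Rightarrow> 'a ell2" where
  "inl_part z = Ell2 (\<lambda>i. coord z (Inl i))"

definition inr_part :: "('a + 'b) ell2 \<Rightarrow> 'b ell2" where
  "inr_part z = Ell2 (\<lambda>i. coord z (Inr i))"

definition dsum_op :: "('a ell2 \<Rightarrow> 'a ell2) \<Rightarrow> ('b ell2 \<Rightarrow> 'b ell2) \<Rightarrow>
    ('a + 'b) ell2 \<Rightarrow> ('a + 'b) ell2" (infixr "\<oplus>\<^sub>o\<^sub>p" 65) where
  "(T \<oplus>\<^sub>o\<^sub>p R) z = dsum_vec (T (inl_part z)) (R (inr_part z))"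

lemma norm_ell2_sq: "(norm x)\<^sup>2 = (\<Sum>\<^sub>\<infinity>i. (cmod (coord x i))\<^sup>2)"
  by (simp add: norm_ell2_def ell2_norm_sq)

lemma norm_ell2_ge: "finite F \<Longrightarrow> (\<Sum>i\<in>F. (cmod (coord x i))\<^sup>2) \<le> (norm x)\<^sup>2"
  by (simp add: norm_ell2_def ell2_norm_ge)

lemma norm_ell2_le:
  "(\<And>F. finite F \<Longrightarrow> (\<Sum>i\<in>F. (cmod (coord x i))\<^sup>2) \<le> b\<^sup>2) \<Longrightarrow> b \<ge> 0 \<Longrightarrow> norm x \<le> b"
  by (simp add: norm_ell2_def ell2_norm_le)

lemma norm_coord_le:
  assumes "bounded_clinear T" shows "\<exists>K\<ge>0. \<forall>x. norm (T x) \<le> K * norm x"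
proof -
  have "bounded_linear T" using assms by (simp add: bounded_clinear_def)
  from bounded_linear.nonneg_bounded[OF this] show ?thesis by (auto simp: mult.commute)
qed

lemma coord_mat_op: "coord (mat_op M x) i = (\<Sum>j\<in>UNIV. M $ i $ j * coord x j)"
proof -
  have "coord (mat_op M x) = (\<lambda>i. (M *v (\<chi> j. coord x j)) $ i)"
    unfolding mat_op_def
    by (rule Ell2_inverse) (auto intro: summable_on_finite)
  then show ?thesis by (simp add: matrix_vector_mult_def)
qed

lemma coord_inl_part [simp]: "coord (inl_part z) i = coord z (Inl i)"
proof -
  have "(\<Sum>i\<in>F. (cmod (coord z (Inl i)))\<^sup>2) \<le> (norm z)\<^sup>2" if "finite F" for F
    using norm_ell2_ge[of "Inl ` F" z] that by (simp add: sum.reindex)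
  then show ?thesis unfolding inl_part_def by (subst Ell2_bound) auto
qed

lemma coord_inr_part [simp]: "coord (inr_part z) i = coord z (Inr i)"
proof -
  have "(\<Sum>i\<in>F. (cmod (coord z (Inr i)))\<^sup>2) \<le> (norm z)\<^sup>2" if "finite F" for F
    using norm_ell2_ge[of "Inr ` F" z] that by (simp add: sum.reindex)
  then show ?thesis unfolding inr_part_def by (subst Ell2_bound) auto
qed

lemma dsum_bound:
  fixes x :: "'a ell2" and y :: "'b ell2"
  assumes "finite F"
  shows "(\<Sum>i\<in>F. (cmod (case_sum (coord x) (coord y) i))\<^sup>2) \<le> (norm x)\<^sup>2 + (norm y)\<^sup>2"
proof -
  have "(\<Sum>i\<in>F. (cmod (case_sum (coord x) (coord y) i))\<^sup>2) =
      (\<Sum>i\<in>Inl -` F <+> Inr -` F. (cmod (case_sum (coord x) (coord y) i))\<^sup>2)"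
    by (rule sum.cong) (auto simp: Plus_def image_iff, metis sum.exhaust)
  also have "\<dots> = (\<Sum>i\<in>Inl -` F. (cmod (coord x i))\<^sup>2) + (\<Sum>i\<in>Inr -` F. (cmod (coord y i))\<^sup>2)"
    by (subst sum.Plus) (use assms in \<open>auto intro: finite_vimageI\<close>)
  also have "\<dots> \<le> (norm x)\<^sup>2 + (norm y)\<^sup>2"
    by (intro add_mono norm_ell2_ge finite_vimageI assms) auto
  finally show ?thesis .
qed

lemma coord_dsum_vec: "coord (dsum_vec x y) = case_sum (coord x) (coord y)"
  unfolding dsum_vec_def by (rule Ell2_bound) (rule dsum_bound)

lemma norm_dsum_vec: "(norm (dsum_vec x y))\<^sup>2 = (norm x)\<^sup>2 + (norm y)\<^sup>2"
proof -
  let ?f = "\<lambda>i. (cmod (case_sum (coord x) (coord y) i))\<^sup>2"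
  have "(norm (dsum_vec x y))\<^sup>2 = infsum ?f (range Inl \<union> range Inr)"
    unfolding norm_ell2_sq coord_dsum_vec by (rule infsum_cong_neutral) (auto, metis sum.exhaust rangeI)
  also have "\<dots> = infsum ?f (range Inl) + infsum ?f (range Inr)"
    by (rule infsum_Un_disjoint)
      (auto simp: summable_on_reindex infsum_reindex o_def coord_summable)
  also have "\<dots> = (norm x)\<^sup>2 + (norm y)\<^sup>2"
    by (simp add: infsum_reindex o_def norm_ell2_sq)
  finally show ?thesis .
qed

lemma dsum_op_vec: "(T \<oplus>\<^sub>o\<^sub>p R) (dsum_vec x y) = dsum_vec (T x) (R y)"
proof -
  have "inl_part (dsum_vec x y) = x" "inr_part (dsum_vec x y) = y"
    by (auto intro!: ell2_eqI simp: coord_dsum_vec)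
  then show ?thesis by (simp add: dsum_op_def)
qed


section \<open>Tensor products\<close>

text \<open>
  The Hilbert space tensor product of \<open>'a ell2\<close> and \<open>'b ell2\<close> is \<open>('a \<times> 'b) ell2\<close>, with
  elementary tensors \<open>tensor_vec\<close>.  The operator \<open>T \<otimes> R\<close> is the product of \<open>T \<otimes> I\<close>, which lets
  \<open>T\<close> act on the first index, and \<open>I \<otimes> R\<close>, which lets \<open>R\<close> act on the second.
\<close>

definition tensor_vec :: "'a ell2 \<Rightarrow> 'b ell2 \<Rightarrow> ('a \<times> 'b) ell2" where
  "tensor_vec x y = Ell2 (\<lambda>(a, b). coord x a * coord y b)"

definition slice_fst :: "('a \<times> 'b) ell2 \<Rightarrow> 'b \<Rightarrow> 'a ell2" where
  "slice_fst z b = Ell2 (\<lambda>a. coord z (a, b))"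

definition slice_snd :: "('a \<times> 'b) ell2 \<Rightarrow> 'a \<Rightarrow> 'b ell2" where
  "slice_snd z a = Ell2 (\<lambda>b. coord z (a, b))"

definition amp_fst :: "('a ell2 \<Rightarrow> 'a ell2) \<Rightarrow> ('a \<times> 'b) ell2 \<Rightarrow> ('a \<times> 'b) ell2" where
  "amp_fst T z = Ell2 (\<lambda>(a, b). coord (T (slice_fst z b)) a)"

definition amp_snd :: "('b ell2 \<Rightarrow> 'b ell2) \<Rightarrow> ('a \<times> 'b) ell2 \<Rightarrow> ('a \<times> 'b) ell2" where
  "amp_snd R z = Ell2 (\<lambda>(a, b). coord (R (slice_snd z a)) b)"

definition tensor_op :: "('a ell2 \<Rightarrow> 'a ell2) \<Rightarrow> ('b ell2 \<Rightarrow> 'b ell2) \<Rightarrow>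
    ('a \<times> 'b) ell2 \<Rightarrow> ('a \<times> 'b) ell2" (infixr "\<otimes>\<^sub>o\<^sub>p" 70) where
  "T \<otimes>\<^sub>o\<^sub>p R = amp_fst T \<circ> amp_snd R"

lemma coord_slice_fst [simp]: "coord (slice_fst z b) a = coord z (a, b)"
proof -
  have "(\<Sum>a\<in>F. (cmod (coord z (a, b)))\<^sup>2) \<le> (norm z)\<^sup>2" if "finite F" for F
    using norm_ell2_ge[of "(\<lambda>a. (a, b)) ` F" z] that by (simp add: sum.reindex inj_on_def)
  then show ?thesis unfolding slice_fst_def by (subst Ell2_bound) auto
qed

lemma coord_slice_snd [simp]: "coord (slice_snd z a) b = coord z (a, b)"
proof -
  have "(\<Sum>b\<in>F. (cmod (coord z (a, b)))\<^sup>2) \<le> (norm z)\<^sup>2" if "finite F" for F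
    using norm_ell2_ge[of "(\<lambda>b. (a, b)) ` F" z] that by (simp add: sum.reindex inj_on_def)
  then show ?thesis unfolding slice_snd_def by (subst Ell2_bound) auto
qed

lemma sum_infsum_swap:
  fixes f :: "'a \<Rightarrow> 'b \<Rightarrow> real"
  assumes "finite B" "\<And>b. b \<in> B \<Longrightarrow> f b summable_on A"
  shows "((\<lambda>a. \<Sum>b\<in>B. f b a) has_sum (\<Sum>b\<in>B. infsum (f b) A)) A"
  using assms by (induction B rule: finite_induct) (auto intro!: has_sum_add)

lemma slice_summable:
  "(\<lambda>a. (cmod (coord z (a, b)))\<^sup>2) summable_on UNIV"
  "(\<lambda>b. (cmod (coord z (a, b)))\<^sup>2) summable_on UNIV"
  using coord_summable[of "slice_fst z b"] coord_summable[of "slice_snd z a"] by simp_all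

lemma sum_slice_fst:
  fixes z :: "('a \<times> 'b) ell2"
  assumes "finite B" shows "(\<Sum>b\<in>B. (norm (slice_fst z b))\<^sup>2) \<le> (norm z)\<^sup>2"
proof -
  have "(\<Sum>b\<in>B. (norm (slice_fst z b))\<^sup>2) = (\<Sum>b\<in>B. \<Sum>\<^sub>\<infinity>a. (cmod (coord z (a, b)))\<^sup>2)"
    by (simp add: norm_ell2_sq)
  also have "\<dots> = (\<Sum>\<^sub>\<infinity>a. \<Sum>b\<in>B. (cmod (coord z (a, b)))\<^sup>2)"
    by (rule infsumI[symmetric], rule sum_infsum_swap) (use assms slice_summable in auto)
  also have "\<dots> \<le> (norm z)\<^sup>2"
  proof (rule infsum_le_finite_sums)
    show "(\<lambda>a. \<Sum>b\<in>B. (cmod (coord z (a, b)))\<^sup>2) summable_on UNIV"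
      by (rule has_sum_imp_summable, rule sum_infsum_swap) (use assms slice_summable in auto)
    fix A :: "'a set" assume "finite A"
    then show "(\<Sum>a\<in>A. \<Sum>b\<in>B. (cmod (coord z (a, b)))\<^sup>2) \<le> (norm z)\<^sup>2"
      using norm_ell2_ge[of "A \<times> B" z] assms by (simp add: sum.cartesian_product)
  qed
  finally show ?thesis .
qed

lemma sum_slice_snd:
  fixes z :: "('a \<times> 'b) ell2"
  assumes "finite A" shows "(\<Sum>a\<in>A. (norm (slice_snd z a))\<^sup>2) \<le> (norm z)\<^sup>2"
proof -
  have "(\<Sum>a\<in>A. (norm (slice_snd z a))\<^sup>2) = (\<Sum>a\<in>A. \<Sum>\<^sub>\<infinity>b. (cmod (coord z (a, b)))\<^sup>2)"
    by (simp add: norm_ell2_sq)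
  also have "\<dots> = (\<Sum>\<^sub>\<infinity>b. \<Sum>a\<in>A. (cmod (coord z (a, b)))\<^sup>2)"
    by (rule infsumI[symmetric], rule sum_infsum_swap) (use assms slice_summable in auto)
  also have "\<dots> \<le> (norm z)\<^sup>2"
  proof (rule infsum_le_finite_sums)
    show "(\<lambda>b. \<Sum>a\<in>A. (cmod (coord z (a, b)))\<^sup>2) summable_on UNIV"
      by (rule has_sum_imp_summable, rule sum_infsum_swap) (use assms slice_summable in auto)
    fix B :: "'b set" assume "finite B"
    then show "(\<Sum>b\<in>B. \<Sum>a\<in>A. (cmod (coord z (a, b)))\<^sup>2) \<le> (norm z)\<^sup>2"
      using norm_ell2_ge[of "A \<times> B" z] assms
      by (subst sum.swap) (simp add: sum.cartesian_product)
  qed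
  finally show ?thesis .
qed

lemma amp_fst_bound:
  fixes z :: "('a \<times> 'b) ell2"
  assumes K: "K \<ge> 0" "\<And>x. norm (T x) \<le> K * norm x" and F: "finite F"
  shows "(\<Sum>p\<in>F. (cmod (case p of (a, b) \<Rightarrow> coord (T (slice_fst z b)) a))\<^sup>2) \<le> (K * norm z)\<^sup>2"
proof -
  have "(\<Sum>p\<in>F. (cmod (case p of (a, b) \<Rightarrow> coord (T (slice_fst z b)) a))\<^sup>2)
      \<le> (\<Sum>p\<in>fst ` F \<times> snd ` F. (cmod (case p of (a, b) \<Rightarrow> coord (T (slice_fst z b)) a))\<^sup>2)"
    by (rule sum_mono2) (use F in \<open>auto simp: subset_fst_snd\<close>)
  also have "\<dots> = (\<Sum>b\<in>snd ` F. \<Sum>a\<in>fst ` F. (cmod (coord (T (slice_fst z b)) a))\<^sup>2)"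
    by (subst sum.swap) (simp add: sum.cartesian_product case_prod_beta)
  also have "\<dots> \<le> (\<Sum>b\<in>snd ` F. (K * norm (slice_fst z b))\<^sup>2)"
    by (intro sum_mono order_trans[OF norm_ell2_ge] power_mono K) (use F in auto)
  also have "\<dots> = K\<^sup>2 * (\<Sum>b\<in>snd ` F. (norm (slice_fst z b))\<^sup>2)"
    by (simp add: power_mult_distrib sum_distrib_left)
  also have "\<dots> \<le> (K * norm z)\<^sup>2"
    unfolding power_mult_distrib by (intro mult_left_mono sum_slice_fst) (use F in auto)
  finally show ?thesis .
qed

lemma amp_snd_bound:
  fixes z :: "('a \<times> 'b) ell2"
  assumes K: "K \<ge> 0" "\<And>x. norm (R x) \<le> K * norm x" and F: "finite F"
  shows "(\<Sum>p\<in>F. (cmod (case p of (a, b) \<Rightarrow> coord (R (slice_snd z a)) b))\<^sup>2) \<le> (K * norm z)\<^sup>2"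
proof -
  have "(\<Sum>p\<in>F. (cmod (case p of (a, b) \<Rightarrow> coord (R (slice_snd z a)) b))\<^sup>2)
      \<le> (\<Sum>p\<in>fst ` F \<times> snd ` F. (cmod (case p of (a, b) \<Rightarrow> coord (R (slice_snd z a)) b))\<^sup>2)"
    by (rule sum_mono2) (use F in \<open>auto simp: subset_fst_snd\<close>)
  also have "\<dots> = (\<Sum>a\<in>fst ` F. \<Sum>b\<in>snd ` F. (cmod (coord (R (slice_snd z a)) b))\<^sup>2)"
    by (simp add: sum.cartesian_product case_prod_beta)
  also have "\<dots> \<le> (\<Sum>a\<in>fst ` F. (K * norm (slice_snd z a))\<^sup>2)"
    by (intro sum_mono order_trans[OF norm_ell2_ge] power_mono K) (use F in auto)
  also have "\<dots> = K\<^sup>2 * (\<Sum>a\<in>fst ` F. (norm (slice_snd z a))\<^sup>2)"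
    by (simp add: power_mult_distrib sum_distrib_left)
  also have "\<dots> \<le> (K * norm z)\<^sup>2"
    unfolding power_mult_distrib by (intro mult_left_mono sum_slice_snd) (use F in auto)
  finally show ?thesis .
qed

lemma coord_amp_fst:
  assumes "bounded_clinear T"
  shows "coord (amp_fst T z) (a, b) = coord (T (slice_fst z b)) a"
proof -
  obtain K where "K \<ge> 0" "\<And>x. norm (T x) \<le> K * norm x" using norm_coord_le[OF assms] by auto
  then show ?thesis unfolding amp_fst_def by (subst Ell2_bound) (rule amp_fst_bound, auto)
qed

lemma coord_amp_snd:
  assumes "bounded_clinear R"
  shows "coord (amp_snd R z) (a, b) = coord (R (slice_snd z a)) b"
proof -
  obtain K where "K \<ge> 0" "\<And>x. norm (R x) \<le> K * norm x" using norm_coord_le[OF assms] by auto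
  then show ?thesis unfolding amp_snd_def by (subst Ell2_bound) (rule amp_snd_bound, auto)
qed

lemma slice_linear:
  "slice_fst (y + z) b = slice_fst y b + slice_fst z b" "slice_fst (c *\<^sub>C z) b = c *\<^sub>C slice_fst z b"
  "slice_snd (y + z) a = slice_snd y a + slice_snd z a" "slice_snd (c *\<^sub>C z) a = c *\<^sub>C slice_snd z a"
  by (auto intro!: ell2_eqI)

lemma bounded_clinear_amp_fst:
  assumes T: "bounded_clinear T" shows "bounded_clinear (amp_fst T)"
proof -
  obtain K where K: "K \<ge> 0" "\<And>x. norm (T x) \<le> K * norm x" using norm_coord_le[OF T] by auto
  have "T (x + y) = T x + T y" "T (c *\<^sub>C x) = c *\<^sub>C T x" for x y c
    using T by (auto simp: bounded_clinear_def linear_simps)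
  note lin = this
  show ?thesis
  proof (rule bounded_clinearI)
    show "amp_fst T (x + y) = amp_fst T x + amp_fst T y" for x y :: "('a \<times> 'b) ell2"
      by (rule ell2_eqI) (auto simp: coord_amp_fst[OF T] slice_linear lin)
    show "amp_fst T (c *\<^sub>C x) = c *\<^sub>C amp_fst T x" for c and x :: "('a \<times> 'b) ell2"
      by (rule ell2_eqI) (auto simp: coord_amp_fst[OF T] slice_linear lin)
    show "norm (amp_fst T x) \<le> K * norm x" for x :: "('a \<times> 'b) ell2"
    proof (rule norm_ell2_le)
      fix F :: "('a \<times> 'b) set" assume "finite F"
      then show "(\<Sum>i\<in>F. (cmod (coord (amp_fst T x) i))\<^sup>2) \<le> (K * norm x)\<^sup>2"
        using amp_fst_bound[OF K, of F x] by (simp add: case_prod_beta flip: coord_amp_fst[OF T])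
    qed (use K in auto)
  qed
qed

lemma bounded_clinear_amp_snd:
  assumes R: "bounded_clinear R" shows "bounded_clinear (amp_snd R)"
proof -
  obtain K where K: "K \<ge> 0" "\<And>x. norm (R x) \<le> K * norm x" using norm_coord_le[OF R] by auto
  have "R (x + y) = R x + R y" "R (c *\<^sub>C x) = c *\<^sub>C R x" for x y c
    using R by (auto simp: bounded_clinear_def linear_simps)
  note lin = this
  show ?thesis
  proof (rule bounded_clinearI)
    show "amp_snd R (x + y) = amp_snd R x + amp_snd R y" for x y :: "('b \<times> 'a) ell2"
      by (rule ell2_eqI) (auto simp: coord_amp_snd[OF R] slice_linear lin)
    show "amp_snd R (c *\<^sub>C x) = c *\<^sub>C amp_snd R x" for c and x :: "('b \<times> 'a) ell2"
      by (rule ell2_eqI) (auto simp: coord_amp_snd[OF R] slice_linear lin)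
    show "norm (amp_snd R x) \<le> K * norm x" for x :: "('b \<times> 'a) ell2"
    proof (rule norm_ell2_le)
      fix F :: "('b \<times> 'a) set" assume "finite F"
      then show "(\<Sum>i\<in>F. (cmod (coord (amp_snd R x) i))\<^sup>2) \<le> (K * norm x)\<^sup>2"
        using amp_snd_bound[OF K, of F x] by (simp add: case_prod_beta flip: coord_amp_snd[OF R])
    qed (use K in auto)
  qed
qed

lemma bounded_clinear_tensor_op:
  "bounded_clinear T \<Longrightarrow> bounded_clinear R \<Longrightarrow> bounded_clinear (T \<otimes>\<^sub>o\<^sub>p R)"
  unfolding tensor_op_def
  by (intro bounded_clinear_compose bounded_clinear_amp_fst bounded_clinear_amp_snd)

lemma coord_tensor_vec [simp]: "coord (tensor_vec x y) (a, b) = coord x a * coord y b"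
proof -
  have "(\<Sum>p\<in>F. (cmod (case p of (a, b) \<Rightarrow> coord x a * coord y b))\<^sup>2) \<le> (norm x)\<^sup>2 * (norm y)\<^sup>2"
    if F: "finite F" for F :: "('a \<times> 'b) set"
  proof -
    have "(\<Sum>p\<in>F. (cmod (case p of (a, b) \<Rightarrow> coord x a * coord y b))\<^sup>2)
        \<le> (\<Sum>p\<in>fst ` F \<times> snd ` F. (cmod (case p of (a, b) \<Rightarrow> coord x a * coord y b))\<^sup>2)"
      by (rule sum_mono2) (use F in \<open>auto simp: subset_fst_snd\<close>)
    also have "\<dots> = (\<Sum>a\<in>fst ` F. (cmod (coord x a))\<^sup>2) * (\<Sum>b\<in>snd ` F. (cmod (coord y b))\<^sup>2)"
      by (simp add: sum_product sum.cartesian_product case_prod_beta norm_mult power_mult_distrib)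
    also have "\<dots> \<le> (norm x)\<^sup>2 * (norm y)\<^sup>2"
      by (intro mult_mono norm_ell2_ge) (use F in \<open>auto intro: sum_nonneg\<close>)
    finally show ?thesis .
  qed
  then show ?thesis unfolding tensor_vec_def by (subst Ell2_bound) auto
qed

lemma tensor_op_vec:
  assumes T: "bounded_clinear T" and R: "bounded_clinear R"
  shows "(T \<otimes>\<^sub>o\<^sub>p R) (tensor_vec x y) = tensor_vec (T x) (R y)"
proof -
  have 1: "amp_snd R (tensor_vec x y) = tensor_vec x (R y)" for x :: "'a ell2"
  proof (rule ell2_eqI, clarify)
    fix a b
    have "slice_snd (tensor_vec x y) a = coord x a *\<^sub>C y" by (rule ell2_eqI) simp
    then show "coord (amp_snd R (tensor_vec x y)) (a, b) = coord (tensor_vec x (R y)) (a, b)"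
      using R by (simp add: coord_amp_snd[OF R] bounded_clinear_def)
  qed
  have 2: "amp_fst T (tensor_vec x y) = tensor_vec (T x) y" for y :: "'b ell2"
  proof (rule ell2_eqI, clarify)
    fix a b
    have "slice_fst (tensor_vec x y) b = coord y b *\<^sub>C x" by (rule ell2_eqI) simp
    then show "coord (amp_fst T (tensor_vec x y)) (a, b) = coord (tensor_vec (T x) y) (a, b)"
      using T by (simp add: coord_amp_fst[OF T] bounded_clinear_def)
  qed
  show ?thesis by (simp add: tensor_op_def 1 2)
qed


section \<open>The space \<open>\<ell>\<^sup>1(n)\<close>\<close>

typedef 'n ell1 = "UNIV :: (complex^'n::finite) set"
  morphisms vec_of_ell1 Ell1 ..

lemma Ell1_inv [simp]: "vec_of_ell1 (Ell1 v) = v"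
  by (simp add: Ell1_inverse)

instantiation ell1 :: (finite) complex_normed_vector
begin

definition zero_ell1 :: "'a ell1" where "0 = Ell1 0"
definition plus_ell1 :: "'a ell1 \<Rightarrow> 'a ell1 \<Rightarrow> 'a ell1" where
  "z + w = Ell1 (vec_of_ell1 z + vec_of_ell1 w)"
definition minus_ell1 :: "'a ell1 \<Rightarrow> 'a ell1 \<Rightarrow> 'a ell1" where
  "z - w = Ell1 (vec_of_ell1 z - vec_of_ell1 w)"
definition uminus_ell1 :: "'a ell1 \<Rightarrow> 'a ell1" where
  "- z = Ell1 (- vec_of_ell1 z)"
definition scaleR_ell1 :: "real \<Rightarrow> 'a ell1 \<Rightarrow> 'a ell1" where
  "r *\<^sub>R z = Ell1 (r *\<^sub>R vec_of_ell1 z)"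
definition scaleC_ell1 :: "complex \<Rightarrow> 'a ell1 \<Rightarrow> 'a ell1" where
  "c *\<^sub>C z = Ell1 (c *s vec_of_ell1 z)"
definition norm_ell1 :: "'a ell1 \<Rightarrow> real" where
  "norm z = (\<Sum>i\<in>UNIV. cmod (vec_of_ell1 z $ i))"
definition dist_ell1 :: "'a ell1 \<Rightarrow> 'a ell1 \<Rightarrow> real" where "dist_ell1 x y = norm (x - y)"
definition sgn_ell1 :: "'a ell1 \<Rightarrow> 'a ell1" where "sgn_ell1 z = inverse (norm z) *\<^sub>R z"
definition uniformity_ell1 :: "('a ell1 \<times> 'a ell1) filter" where
  "uniformity_ell1 = (INF e\<in>{0<..}. principal {(x, y). dist x y < e})"
definition open_ell1 :: "'a ell1 set \<Rightarrow> bool" where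
  "open_ell1 U \<longleftrightarrow> (\<forall>x\<in>U. \<forall>\<^sub>F (x', y) in uniformity. x' = x \<longrightarrow> y \<in> U)"

instance
proof
  fix x y z :: "'a ell1" and r s :: real and c d :: complex and U :: "'a ell1 set"
  show "x + y + z = x + (y + z)" "x + y = y + x" "0 + x = x" "- x + x = 0" "x - y = x + - y"
    "r *\<^sub>R (x + y) = r *\<^sub>R x + r *\<^sub>R y" "(r + s) *\<^sub>R x = r *\<^sub>R x + s *\<^sub>R x"
    "r *\<^sub>R s *\<^sub>R x = (r * s) *\<^sub>R x" "1 *\<^sub>R x = x"
    "c *\<^sub>C (x + y) = c *\<^sub>C x + c *\<^sub>C y" "(c + d) *\<^sub>C x = c *\<^sub>C x + d *\<^sub>C x"
    "c *\<^sub>C d *\<^sub>C x = (c * d) *\<^sub>C x" "r *\<^sub>R x = complex_of_real r *\<^sub>C x"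
    by (auto simp: vec_of_ell1_inject[symmetric] plus_ell1_def zero_ell1_def minus_ell1_def
        uminus_ell1_def scaleR_ell1_def scaleC_ell1_def vec_eq_iff algebra_simps
        vector_scalar_mult_def scaleR_conv_of_real[where 'a = complex])
  show "norm (r *\<^sub>R x) = \<bar>r\<bar> * norm x" "norm (c *\<^sub>C x) = cmod c * norm x"
    by (simp_all add: norm_ell1_def scaleR_ell1_def scaleC_ell1_def norm_mult sum_distrib_left)
  show "norm (x + y) \<le> norm x + norm y"
    by (auto simp: norm_ell1_def plus_ell1_def norm_triangle_ineq
        simp flip: sum.distrib intro!: sum_mono)
  show "norm x = 0 \<longleftrightarrow> x = 0"
    by (auto simp: norm_ell1_def zero_ell1_def vec_of_ell1_inject[symmetric] vec_eq_iff
        sum_nonneg_eq_0_iff)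
qed (rule dist_ell1_def sgn_ell1_def uniformity_ell1_def open_ell1_def)+

end


section \<open>Operator space structures\<close>

text \<open>
  The norm of the operator on \<open>\<bbbK>\<^sup>k\<close> given by the \<open>k \<times> k\<close> block matrix \<open>A\<close> of operators on \<open>\<bbbK>\<close>;
  only entries with indices below \<open>k\<close> matter.  For \<open>\<bbbK> = \<complex>\<close> this is the norm of \<open>M\<^sub>k\<close>.
\<close>

definition block_norm ::
    "nat \<Rightarrow> (nat \<Rightarrow> nat \<Rightarrow> 'h::real_normed_vector \<Rightarrow> 'h) \<Rightarrow> real" where
  "block_norm k A =
     (SUP x\<in>{x :: nat \<Rightarrow> 'h. L2_set (\<lambda>j. norm (x j)) {..<k} \<le> 1}.
        L2_set (\<lambda>i. norm (\<Sum>j<k. A i j (x j))) {..<k})"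

text \<open>A matrix norm family: \<open>N k v\<close> is the norm of \<open>(v i j)\<^bsub>i,j<k\<^esub>\<close> in \<open>M\<^sub>k(W)\<close>.\<close>

type_synonym 'w matrix_norms = "nat \<Rightarrow> (nat \<Rightarrow> nat \<Rightarrow> 'w) \<Rightarrow> real"

definition MIN_norms :: "'w::complex_normed_vector matrix_norms" where
  "MIN_norms k v =
     (SUP g\<in>{g :: 'w \<Rightarrow> complex. bounded_clinear g \<and> onorm g \<le> 1}.
        block_norm k (\<lambda>i j x. g (v i j) * x))"

definition induced_norms ::
    "('w \<Rightarrow> 'h::complex_normed_vector \<Rightarrow> 'h) \<Rightarrow> 'w matrix_norms" where
  "induced_norms S k v = block_norm k (\<lambda>i j. S (v i j))"

definition linear_into_B ::
    "('w::complex_normed_vector \<Rightarrow> 'h::complex_normed_vector \<Rightarrow> 'h) \<Rightarrow> bool" where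
  "linear_into_B S \<longleftrightarrow> (\<forall>z. bounded_clinear (S z)) \<and>
     (\<forall>z w x. S (z + w) x = S z x + S w x) \<and> (\<forall>c z x. S (c *\<^sub>C z) x = c *\<^sub>C S z x)"

definition isometry_into_B ::
    "('w::complex_normed_vector \<Rightarrow> 'h::complex_normed_vector \<Rightarrow> 'h) \<Rightarrow> bool" where
  "isometry_into_B S \<longleftrightarrow> linear_into_B S \<and> (\<forall>z. onorm (S z) = norm z)"

text \<open>
  All amplifications of \<open>S\<close> are isometries from \<open>M\<^sub>k(W)\<close>, normed by \<open>N\<close>, into the
  \<open>k \<times> k\<close> matrices over the bounded operators.
\<close>

definition complete_isometry_into_B ::
    "'w::complex_normed_vector matrix_norms \<Rightarrow> ('w \<Rightarrow> 'h::complex_normed_vector \<Rightarrow> 'h) \<Rightarrow> bool" where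
  "complete_isometry_into_B N S \<longleftrightarrow> linear_into_B S \<and>
     (\<forall>k\<ge>1. \<forall>v. block_norm k (\<lambda>i j. S (v i j)) = N k v)"

end

theory Submission
  imports Defs
begin

text \<open>
  Isometry.  Every \<open>S\<^sub>i\<close> is built from contractions, so \<open>\<parallel>S z\<parallel> \<le> \<bar>z\<^sub>1\<bar> + \<bar>z\<^sub>2\<bar> + \<bar>z\<^sub>3\<bar>\<close>.  Conversely the
  diagonal entries of \<open>D\<close> accumulate at every point of the unit circle
  (\<open>spectrum_diagonal_approx\<close>), and the tensor product lets the three copies of \<open>D\<close> choose their
  entries independently: the basis vector \<open>e\<^sub>a \<otimes> e\<^sub>b \<otimes> e\<^sub>c\<close> is an eigenvector of \<open>S z\<close> with
  eigenvalue \<open>z\<^sub>1 d\<^sub>a + z\<^sub>2 d\<^sub>b + z\<^sub>3 d\<^sub>c\<close>, and by \<open>diagonal_phase_approx\<close> all three summands can be made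
  almost equal to the moduli \<open>\<bar>z\<^sub>i\<bar>\<close>.

  Failure of complete isometry.  Regard \<open>v = (1, U, V)\<close> as a \<open>2 \<times> 2\<close> matrix over \<open>\<ell>\<^sup>1(3)\<close>.  The summand
  \<open>\<complex>\<^sup>2\<close> turns \<open>v\<close> into \<open>1 \<otimes> 1 + U \<otimes> U + V \<otimes> V\<close>, and as \<open>A \<otimes> A\<close> fixes the maximally entangled vector for
  every real orthogonal \<open>A\<close> (\<open>orthogonal_fixes_entangled\<close>), the induced norm of \<open>v\<close> is at least \<open>3\<close>.
  For the MIN norm a functional is a triple \<open>(p, q, r)\<close> of numbers of modulus at most \<open>1\<close>, and the
  matrix \<open>p 1 + q U + r V\<close> has squared Frobenius norm
  \<open>2 (\<bar>p\<bar>\<^sup>2 + \<bar>q\<bar>\<^sup>2 + \<bar>r\<bar>\<^sup>2 + Re (p r\<^sup>*)) \<le> 8\<close>, because \<open>tr U = tr (U\<^sup>T V) = 0\<close> and \<open>tr V = 1\<close>.  As the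
  Frobenius norm dominates the operator norm (\<open>block_norm_le_Frobenius\<close>), the MIN norm of \<open>v\<close> is at
  most \<open>\<surd>8 < 3\<close>.
\<close>

section \<open>Contractions on \<open>\<ell>\<^sup>2\<close> spaces\<close>

definition contraction :: "('a::complex_normed_vector \<Rightarrow> 'b::complex_normed_vector) \<Rightarrow> bool" where
  "contraction T \<longleftrightarrow> bounded_clinear T \<and> (\<forall>x. norm (T x) \<le> norm x)"

lemma contractionI:
  assumes "\<And>x y. T (x + y) = T x + T y" "\<And>c x. T (c *\<^sub>C x) = c *\<^sub>C T x"
    and "\<And>x. norm (T x) \<le> norm x"
  shows "contraction T"
  unfolding contraction_def using bounded_clinearI[of T 1] assms by simp

lemma contraction_bounded: "contraction T \<Longrightarrow> bounded_clinear T"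
  by (simp add: contraction_def)

lemma contraction_norm: "contraction T \<Longrightarrow> norm (T x) \<le> norm x"
  by (simp add: contraction_def)

lemma bounded_clinear_simps:
  assumes "bounded_clinear T"
  shows "T (x + y) = T x + T y" "T (c *\<^sub>C x) = c *\<^sub>C T x" "T 0 = 0"
  using assms by (auto simp: bounded_clinear_def linear_simps)

lemma contraction_id: "contraction id"
  by (rule contractionI) auto

lemma contraction_onorm:
  assumes "bounded_clinear T" "onorm T \<le> 1"
  shows "contraction T"
  unfolding contraction_def
proof (intro conjI allI)
  fix x
  have "norm (T x) \<le> onorm T * norm x"
    using assms(1) by (intro onorm) (simp add: bounded_clinear_def)
  also have "\<dots> \<le> 1 * norm x"
    using assms(2) by (rule mult_right_mono) simp
  finally show "norm (T x) \<le> norm x" by simp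
qed (fact assms(1))

lemma dsum_vec_parts: "dsum_vec (inl_part z) (inr_part z) = z"
  by (rule ell2_eqI) (simp add: coord_dsum_vec split: sum.split)

lemma contraction_dsum_op:
  assumes T: "contraction T" and R: "contraction R"
  shows "contraction (T \<oplus>\<^sub>o\<^sub>p R)"
proof (rule contractionI)
  note lin = bounded_clinear_simps[OF contraction_bounded[OF T]]
    bounded_clinear_simps[OF contraction_bounded[OF R]]
  fix x y :: "('a + 'b) ell2" and c
  have "inl_part (x + y) = inl_part x + inl_part y" "inr_part (x + y) = inr_part x + inr_part y"
    "inl_part (c *\<^sub>C x) = c *\<^sub>C inl_part x" "inr_part (c *\<^sub>C x) = c *\<^sub>C inr_part x"
    by (auto intro!: ell2_eqI)
  then show "(T \<oplus>\<^sub>o\<^sub>p R) (x + y) = (T \<oplus>\<^sub>o\<^sub>p R) x + (T \<oplus>\<^sub>o\<^sub>p R) y"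
    and "(T \<oplus>\<^sub>o\<^sub>p R) (c *\<^sub>C x) = c *\<^sub>C (T \<oplus>\<^sub>o\<^sub>p R) x"
    by (auto intro!: ell2_eqI simp: dsum_op_def coord_dsum_vec lin split: sum.split)
  have "(norm ((T \<oplus>\<^sub>o\<^sub>p R) x))\<^sup>2 = (norm (T (inl_part x)))\<^sup>2 + (norm (R (inr_part x)))\<^sup>2"
    by (simp add: dsum_op_def norm_dsum_vec)
  also have "\<dots> \<le> (norm (inl_part x))\<^sup>2 + (norm (inr_part x))\<^sup>2"
    by (intro add_mono power_mono contraction_norm T R) auto
  also have "\<dots> = (norm x)\<^sup>2"
    by (simp add: dsum_vec_parts flip: norm_dsum_vec)
  finally show "norm ((T \<oplus>\<^sub>o\<^sub>p R) x) \<le> norm x"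
    by (rule power2_le_imp_le) simp
qed

text \<open>
  The bounds on \<open>T \<otimes> I\<close> and \<open>I \<otimes> R\<close> apply \<open>T\<close> or \<open>R\<close> to each slice of a vector; with the constant
  \<open>1\<close> they show that both factors of \<open>T \<otimes> R\<close> are contractions.
\<close>

lemma contraction_tensor_op:
  assumes T: "contraction T" and R: "contraction R"
  shows "contraction (T \<otimes>\<^sub>o\<^sub>p R)"
  unfolding contraction_def
proof (intro conjI allI)
  note bT = contraction_bounded[OF T] and bR = contraction_bounded[OF R]
  show "bounded_clinear (T \<otimes>\<^sub>o\<^sub>p R)"
    using bT bR by (rule bounded_clinear_tensor_op)
  have 1: "norm (amp_fst T z) \<le> norm z" for z :: "('a \<times> 'b) ell2"
  proof (rule norm_ell2_le)
    fix F :: "('a \<times> 'b) set" assume "finite F"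
    then show "(\<Sum>i\<in>F. (cmod (coord (amp_fst T z) i))\<^sup>2) \<le> (norm z)\<^sup>2"
      using amp_fst_bound[of 1 T F z] contraction_norm[OF T]
      by (simp add: case_prod_beta flip: coord_amp_fst[OF bT])
  qed simp
  have 2: "norm (amp_snd R z) \<le> norm z" for z :: "('a \<times> 'b) ell2"
  proof (rule norm_ell2_le)
    fix F :: "('a \<times> 'b) set" assume "finite F"
    then show "(\<Sum>i\<in>F. (cmod (coord (amp_snd R z) i))\<^sup>2) \<le> (norm z)\<^sup>2"
      using amp_snd_bound[of 1 R F z] contraction_norm[OF R]
      by (simp add: case_prod_beta flip: coord_amp_snd[OF bR])
  qed simp
  show "norm ((T \<otimes>\<^sub>o\<^sub>p R) z) \<le> norm z" for z
    using order_trans[OF 1 2] by (simp add: tensor_op_def)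
qed


section \<open>Real orthogonal matrices acting on \<open>\<complex>\<^sup>n\<close>\<close>

definition complexify :: "real^'n^'m \<Rightarrow> complex^'n^'m" where
  "complexify A = (\<chi> i j. complex_of_real (A $ i $ j))"

lemma norm_ell2_finite: "(norm (x :: 'n::finite ell2))\<^sup>2 = (\<Sum>i\<in>UNIV. (cmod (coord x i))\<^sup>2)"
  by (simp add: norm_ell2_sq)

text \<open>
  A real matrix acts separately on the real and the imaginary part of a vector, so orthogonality
  over the reals is enough for the norm on \<open>\<complex>\<^sup>n\<close>.
\<close>

lemma norm_mat_op_orthogonal:
  fixes A :: "real^'n^'n"
  assumes "orthogonal_matrix A"
  shows "norm (mat_op (complexify A) x) = norm x"
proof -
  have iso: "norm (A *v r) = norm r" for r :: "real^'n"
    using assms orthogonal_transformation_matrix[of "(*v) A"]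
    by (simp add: orthogonal_transformation_norm)
  have split: "(norm y)\<^sup>2 = (norm (\<chi> i. Re (coord y i)))\<^sup>2 + (norm (\<chi> i. Im (coord y i)))\<^sup>2"
    for y :: "'n ell2"
    unfolding norm_ell2_finite cmod_power2 sum.distrib power2_norm_eq_inner
    by (simp add: inner_vec_def power2_eq_square)
  have "(\<chi> i. Re (coord (mat_op (complexify A) x) i)) = A *v (\<chi> i. Re (coord x i))"
    "(\<chi> i. Im (coord (mat_op (complexify A) x) i)) = A *v (\<chi> i. Im (coord x i))"
    by (simp_all add: vec_eq_iff coord_mat_op complexify_def matrix_vector_mult_def)
  then have "(norm (mat_op (complexify A) x))\<^sup>2 = (norm x)\<^sup>2"
    by (simp add: split iso)
  then show ?thesis by simp
qed

lemma contraction_mat_op_orthogonal: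
  assumes "orthogonal_matrix A"
  shows "contraction (mat_op (complexify A))"
  by (rule contractionI)
    (auto intro!: ell2_eqI simp: coord_mat_op norm_mat_op_orthogonal[OF assms]
      sum.distrib sum_distrib_left algebra_simps)

definition ket :: "'a \<Rightarrow> 'a ell2" where
  "ket a = Ell2 (\<lambda>i. of_bool (i = a))"

lemma coord_ket [simp]: "coord (ket a) i = of_bool (i = a)"
proof -
  have "(\<Sum>i\<in>F. (cmod (of_bool (i = a)))\<^sup>2) \<le> 1" if "finite F" for F
  proof -
    have "(\<Sum>i\<in>F. (cmod (of_bool (i = a)))\<^sup>2) = (\<Sum>i\<in>F. of_bool (i = a))"
      by (rule sum.cong) auto
    also have "\<dots> \<le> 1" using that card_mono[of "{a}" "F \<inter> {a}"] by simp
    finally show ?thesis .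
  qed
  then show ?thesis unfolding ket_def by (subst Ell2_bound) auto
qed

lemma norm_ket [simp]: "norm (ket a) = 1"
proof -
  have "(norm (ket a))\<^sup>2 = (\<Sum>\<^sub>\<infinity>i\<in>{a}. (cmod (coord (ket a) i))\<^sup>2)"
    unfolding norm_ell2_sq by (rule infsum_cong_neutral) auto
  then have "(norm (ket a))\<^sup>2 = 1\<^sup>2" by simp
  then show ?thesis
    by (metis norm_ge_zero power2_eq_iff_nonneg zero_le_one)
qed

lemma scaleC_ell2_zero [simp]: "c *\<^sub>C (0 :: 'a ell2) = 0"
  by (rule ell2_eqI) simp

lemma tensor_vec_ket: "tensor_vec (ket a) (ket b) = ket (a, b)"
  by (rule ell2_eqI) auto

lemma dsum_vec_ket: "dsum_vec (ket a) 0 = ket (Inl a)" "dsum_vec 0 (ket b) = ket (Inr b)"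
  by (auto intro!: ell2_eqI simp: coord_dsum_vec split: sum.split)

lemma dsum_vec_linear:
  "dsum_vec x y + dsum_vec x' y' = dsum_vec (x + x') (y + y')"
  "c *\<^sub>C dsum_vec x y = dsum_vec (c *\<^sub>C x) (c *\<^sub>C y)"
  by (auto intro!: ell2_eqI simp: coord_dsum_vec split: sum.split)

lemma dsum_vec_sum: "(\<Sum>j\<in>J. dsum_vec 0 (h j)) = dsum_vec 0 (\<Sum>j\<in>J. h j)"
proof (induction J rule: infinite_finite_induct)
  case (insert j J)
  then show ?case by (simp add: dsum_vec_linear)
qed (auto intro!: ell2_eqI simp: coord_dsum_vec split: sum.split)

lemma tensor_vec_scaleC:
  "tensor_vec (c *\<^sub>C x) y = c *\<^sub>C tensor_vec x y"
  "tensor_vec x (c *\<^sub>C y) = c *\<^sub>C tensor_vec x y"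
  by (auto intro!: ell2_eqI)

text \<open>
  The identity \<open>A A\<^sup>T = 1\<close> in disguise: the \<open>i\<close>-th component of the fact that \<open>A \<otimes> A\<close> fixes the
  maximally entangled vector \<open>\<Sum>\<^sub>j e\<^sub>j \<otimes> e\<^sub>j\<close>.
\<close>

lemma orthogonal_fixes_entangled:
  fixes A :: "real^'n^'n"
  assumes "orthogonal_matrix A"
  shows "(\<Sum>j\<in>UNIV. complexify A $ i $ j *\<^sub>C mat_op (complexify A) (ket j)) = ket i"
proof (rule ell2_eqI)
  fix l
  have [simp]: "coord (\<Sum>j\<in>J. f j) l = (\<Sum>j\<in>J. coord (f j) l)" for f :: "'n \<Rightarrow> 'n ell2" and J
    by (induction J rule: infinite_finite_induct) auto
  have "(\<Sum>j\<in>UNIV. A $ l $ j * A $ i $ j) = (A ** transpose A) $ l $ i"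
    by (simp add: matrix_matrix_mult_def transpose_def)
  also have "\<dots> = of_bool (l = i)"
    using assms by (simp add: orthogonal_matrix_def mat_def)
  finally have "complex_of_real (\<Sum>j\<in>UNIV. A $ l $ j * A $ i $ j) = of_bool (l = i)"
    by simp
  then show "coord (\<Sum>j\<in>UNIV. complexify A $ i $ j *\<^sub>C mat_op (complexify A) (ket j)) l
      = coord (ket i) l"
    by (simp add: coord_mat_op complexify_def of_bool_def if_distrib mult.commute cong: if_cong)
qed


section \<open>The spectrum of a diagonal operator\<close>

text \<open>
  If the diagonal entries stayed away from \<open>z\<close>, dividing by \<open>d i - z\<close> would invert \<open>D - z\<close>.
\<close>

lemma spectrum_diagonal_approx:
  assumes d: "\<And>x i. coord (D x) i = d i * coord x i"
    and z: "z \<in> spectrum D" and e: "e > 0"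
  shows "\<exists>i. cmod (d i - z) < e"
proof (rule ccontr)
  assume "\<not> ?thesis"
  then have far: "cmod (d i - z) \<ge> e" for i by (simp add: not_less)
  have nz: "d i - z \<noteq> 0" for i using far[of i] e by auto
  define R where "R x = Ell2 (\<lambda>i. inverse (d i - z) * coord x i)" for x
  have bound: "(\<Sum>i\<in>F. (cmod (inverse (d i - z) * coord x i))\<^sup>2) \<le> (inverse e * norm x)\<^sup>2"
    if "finite F" for F x
  proof -
    have "(\<Sum>i\<in>F. (cmod (inverse (d i - z) * coord x i))\<^sup>2)
        \<le> (\<Sum>i\<in>F. (inverse e)\<^sup>2 * (cmod (coord x i))\<^sup>2)"
      unfolding norm_mult power_mult_distrib norm_inverse
      by (intro sum_mono mult_right_mono power_mono le_imp_inverse_le far e) auto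
    also have "\<dots> = (inverse e)\<^sup>2 * (\<Sum>i\<in>F. (cmod (coord x i))\<^sup>2)"
      by (simp add: sum_distrib_left)
    also have "\<dots> \<le> (inverse e)\<^sup>2 * (norm x)\<^sup>2"
      by (intro mult_left_mono norm_ell2_ge that) auto
    finally show ?thesis by (simp add: power_mult_distrib)
  qed
  have R: "coord (R x) i = inverse (d i - z) * coord x i" for x i
    unfolding R_def by (subst Ell2_bound) (rule bound, auto)
  have "bounded_clinear R"
  proof (rule bounded_clinearI)
    show "norm (R x) \<le> inverse e * norm x" for x
      by (rule norm_ell2_le) (use bound e in \<open>auto simp: R\<close>)
  qed (auto intro!: ell2_eqI simp: R algebra_simps)
  moreover have "R \<circ> (\<lambda>x. D x - z *\<^sub>C x) = id" "(\<lambda>x. D x - z *\<^sub>C x) \<circ> R = id"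
    using nz by (auto intro!: ell2_eqI simp: fun_eq_iff R d field_simps)
  ultimately show False using z by (auto simp: spectrum_def)
qed

text \<open>
  Near every unimodular number there is a diagonal entry, in particular near the one that rotates
  \<open>w\<close> onto the positive half-line.  The error is stated relative to \<open>\<bar>w\<bar>\<close> so that the errors of
  several \<open>w\<close> add up to a multiple of their \<open>\<ell>\<^sup>1\<close> norm.
\<close>

lemma diagonal_phase_approx:
  assumes d: "\<And>x i. coord (D x) i = d i * coord x i"
    and sp: "sphere 0 1 \<subseteq> spectrum D" and e: "e > 0"
  shows "\<exists>i. cmod (w * d i - of_real (cmod w)) \<le> e * cmod w"
proof -
  define l where "l = (if w = 0 then 1 else cnj (sgn w))"
  have l: "cmod l = 1" "w * l = of_real (cmod w)"
  proof -
    show "cmod l = 1" by (simp add: l_def norm_sgn)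
    show "w * l = of_real (cmod w)"
      using complex_norm_square[of w]
      by (simp add: l_def sgn_div_norm scaleR_conv_of_real field_simps power2_eq_square)
  qed
  have "l \<in> spectrum D" using l(1) sp by auto
  then obtain i where i: "cmod (d i - l) < e"
    using spectrum_diagonal_approx[OF d _ e, of l] by blast
  have "w * d i - of_real (cmod w) = w * (d i - l)"
    by (simp add: l(2)[symmetric] algebra_simps)
  then show ?thesis
    using mult_left_mono[of "cmod (d i - l)" e "cmod w"] i
    by (auto simp: norm_mult mult.commute intro!: exI[of _ i])
qed


section \<open>Block norms\<close>

text \<open>
  A supremum in the reals bounds its members only if it is taken over a bounded set; boundedness of
  the entries of the block matrix provides this.
\<close>

lemma block_norm_ge:
  fixes A :: "nat \<Rightarrow> nat \<Rightarrow> 'a::complex_normed_vector \<Rightarrow> 'a"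
  assumes A: "\<And>i j. bounded_clinear (A i j)"
    and x: "L2_set (\<lambda>j. norm (x j)) {..<k} \<le> 1"
  shows "L2_set (\<lambda>i. norm (\<Sum>j<k. A i j (x j))) {..<k} \<le> block_norm k A"
  unfolding block_norm_def
proof (rule cSUP_upper)
  obtain K where K: "\<And>i j x. norm (A i j x) \<le> K i j * norm x" "\<And>i j. K i j \<ge> 0"
    using norm_coord_le[OF A] by metis
  show "bdd_above ((\<lambda>x. L2_set (\<lambda>i. norm (\<Sum>j<k. A i j (x j))) {..<k}) `
      {x. L2_set (\<lambda>j. norm (x j)) {..<k} \<le> 1})"
  proof (rule bdd_aboveI2)
    fix y :: "nat \<Rightarrow> 'a" assume "y \<in> {x. L2_set (\<lambda>j. norm (x j)) {..<k} \<le> 1}"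
    then have y: "norm (y j) \<le> 1" if "j < k" for j
      using member_le_L2_set[of "{..<k}" j "\<lambda>j. norm (y j)"] that by auto
    have "L2_set (\<lambda>i. norm (\<Sum>j<k. A i j (y j))) {..<k} \<le> (\<Sum>i<k. norm (\<Sum>j<k. A i j (y j)))"
      by (rule L2_set_le_sum) simp
    also have "\<dots> \<le> (\<Sum>i<k. \<Sum>j<k. K i j)"
    proof (intro sum_mono sum_norm_le)
      fix i j assume "j \<in> {..<k}"
      then have "K i j * norm (y j) \<le> K i j * 1"
        by (intro mult_left_mono K y) auto
      then show "norm (A i j (y j)) \<le> K i j" using K(1)[of i j "y j"] by simp
    qed
    finally show "L2_set (\<lambda>i. norm (\<Sum>j<k. A i j (y j))) {..<k} \<le> (\<Sum>i<k. \<Sum>j<k. K i j)" .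
  qed
qed (use x in auto)

text \<open>This is the Cauchy--Schwarz inequality in each row.\<close>

lemma block_norm_le_Frobenius:
  fixes B :: "nat \<Rightarrow> nat \<Rightarrow> complex"
  shows "block_norm k (\<lambda>i j x. B i j * x) \<le> sqrt (\<Sum>i<k. \<Sum>j<k. (cmod (B i j))\<^sup>2)"
  unfolding block_norm_def
proof (rule cSUP_least)
  show "{x :: nat \<Rightarrow> complex. L2_set (\<lambda>j. norm (x j)) {..<k} \<le> 1} \<noteq> {}"
    by (auto intro!: exI[of _ "\<lambda>_. 0"] simp: L2_set_def)
next
  fix x :: "nat \<Rightarrow> complex" assume "x \<in> {x. L2_set (\<lambda>j. norm (x j)) {..<k} \<le> 1}"
  then have x: "L2_set (\<lambda>j. norm (x j)) {..<k} \<le> 1" by simp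
  have "cmod (\<Sum>j<k. B i j * x j) \<le> L2_set (\<lambda>j. cmod (B i j)) {..<k}" for i
  proof -
    have "cmod (\<Sum>j<k. B i j * x j) \<le> (\<Sum>j<k. \<bar>cmod (B i j)\<bar> * \<bar>cmod (x j)\<bar>)"
      by (rule sum_norm_le) (simp add: norm_mult)
    also have "\<dots> \<le> L2_set (\<lambda>j. cmod (B i j)) {..<k} * L2_set (\<lambda>j. cmod (x j)) {..<k}"
      by (rule L2_set_mult_ineq)
    also have "\<dots> \<le> L2_set (\<lambda>j. cmod (B i j)) {..<k} * 1"
      using x by (intro mult_left_mono) auto
    finally show ?thesis by simp
  qed
  then have "L2_set (\<lambda>i. norm (\<Sum>j<k. B i j * x j)) {..<k}
      \<le> L2_set (\<lambda>i. L2_set (\<lambda>j. cmod (B i j)) {..<k}) {..<k}"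
    by (intro L2_set_mono) auto
  also have "\<dots> = sqrt (\<Sum>i<k. \<Sum>j<k. (cmod (B i j))\<^sup>2)"
    by (simp add: L2_set_def sum_nonneg)
  finally show "L2_set (\<lambda>i. norm (\<Sum>j<k. B i j * x j)) {..<k} \<le> sqrt (\<Sum>i<k. \<Sum>j<k. (cmod (B i j))\<^sup>2)" .
qed

lemma MIN_norms_le:
  assumes "\<And>g. bounded_clinear g \<Longrightarrow> (\<And>z. cmod (g z) \<le> norm z) \<Longrightarrow>
      (\<Sum>i<k. \<Sum>j<k. (cmod (g (v i j)))\<^sup>2) \<le> b"
  shows "MIN_norms k v \<le> sqrt b"
  unfolding MIN_norms_def
proof (rule cSUP_least)
  have "bounded_clinear (\<lambda>_::'a. 0 :: complex)"
    by (rule bounded_clinearI[of _ 0]) (auto simp: scaleC_complex_def)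
  then show "{g :: 'a \<Rightarrow> complex. bounded_clinear g \<and> onorm g \<le> 1} \<noteq> {}"
    by (auto intro!: exI[of _ "\<lambda>_. 0"] simp: onorm_zero)
next
  fix g :: "'a \<Rightarrow> complex" assume "g \<in> {g. bounded_clinear g \<and> onorm g \<le> 1}"
  then have "contraction g" by (auto intro: contraction_onorm)
  then have "(\<Sum>i<k. \<Sum>j<k. (cmod (g (v i j)))\<^sup>2) \<le> b"
    by (intro assms contraction_bounded contraction_norm)
  then show "block_norm k (\<lambda>i j x. g (v i j) * x) \<le> sqrt b"
    using block_norm_le_Frobenius[of k "\<lambda>i j. g (v i j)"] by (meson order_trans real_sqrt_le_mono)
qed


section \<open>Functionals on \<open>\<ell>\<^sup>1(3)\<close>\<close>

lemma ell1_3_functional: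
  fixes g :: "3 ell1 \<Rightarrow> complex"
  assumes "bounded_clinear g"
  shows "g z = vec_of_ell1 z $ 1 * g (Ell1 (axis 1 1)) + vec_of_ell1 z $ 2 * g (Ell1 (axis 2 1))
    + vec_of_ell1 z $ 3 * g (Ell1 (axis 3 1))"
proof -
  have "z = vec_of_ell1 z $ 1 *\<^sub>C Ell1 (axis 1 1) + vec_of_ell1 z $ 2 *\<^sub>C Ell1 (axis 2 1)
      + vec_of_ell1 z $ 3 *\<^sub>C Ell1 (axis 3 1)"
    by (simp add: vec_of_ell1_inject[symmetric] plus_ell1_def scaleC_ell1_def vec_eq_iff
        forall_3 axis_def)
  then have "g z = g (vec_of_ell1 z $ 1 *\<^sub>C Ell1 (axis 1 1) + vec_of_ell1 z $ 2 *\<^sub>C Ell1 (axis 2 1)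
      + vec_of_ell1 z $ 3 *\<^sub>C Ell1 (axis 3 1))"
    by (rule arg_cong)
  then show ?thesis
    by (simp add: bounded_clinear_simps[OF assms] scaleC_complex_def)
qed

lemma norm_ell1_axis: "norm (Ell1 (axis i 1)) = 1"
  by (simp add: norm_ell1_def axis_def if_distrib[of cmod] cong: if_cong)


section \<open>The operator space structure induced by \<open>S\<close>\<close>

theorem mainTheorem10:
  fixes D :: "int ell2 \<Rightarrow> int ell2"
    and U V :: "complex^2^2"
    and T1 T2 T3 :: "(2 + int) ell2 \<Rightarrow> (2 + int) ell2"
    and That1 That2 That3 ::
      "((2 + int) \<times> (2 + int) \<times> (2 + int)) ell2 \<Rightarrow> ((2 + int) \<times> (2 + int) \<times> (2 + int)) ell2"
    and S1 S2 S3 :: "((2 + int) \<times> (2 + int) \<times> (2 + int) + 2) ell2 \<Rightarrow>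
      ((2 + int) \<times> (2 + int) \<times> (2 + int) + 2) ell2"
    and S :: "3 ell1 \<Rightarrow> ((2 + int) \<times> (2 + int) \<times> (2 + int) + 2) ell2 \<Rightarrow>
      ((2 + int) \<times> (2 + int) \<times> (2 + int) + 2) ell2"
  assumes U: "U = vector [vector [1 / 2, complex_of_real (sqrt 3) / 2],
                          vector [complex_of_real (sqrt 3) / 2, - 1 / 2]]"
    and V: "V = vector [vector [1 / 2, - complex_of_real (sqrt 3) / 2],
                        vector [complex_of_real (sqrt 3) / 2, 1 / 2]]"
    and D: "bounded_clinear D" "diagonal_op D" "onorm D \<le> 1" "sphere 0 1 \<subseteq> spectrum D"
    and T1: "T1 = mat_op (mat 1) \<oplus>\<^sub>o\<^sub>p D"
    and T2: "T2 = mat_op U \<oplus>\<^sub>o\<^sub>p D"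
    and T3: "T3 = mat_op V \<oplus>\<^sub>o\<^sub>p D"
    and That1: "That1 = T1 \<otimes>\<^sub>o\<^sub>p id \<otimes>\<^sub>o\<^sub>p id"
    and That2: "That2 = id \<otimes>\<^sub>o\<^sub>p T2 \<otimes>\<^sub>o\<^sub>p id"
    and That3: "That3 = id \<otimes>\<^sub>o\<^sub>p id \<otimes>\<^sub>o\<^sub>p T3"
    and S1: "S1 = That1 \<oplus>\<^sub>o\<^sub>p mat_op (mat 1)"
    and S2: "S2 = That2 \<oplus>\<^sub>o\<^sub>p mat_op U"
    and S3: "S3 = That3 \<oplus>\<^sub>o\<^sub>p mat_op V"
    and S: "S = (\<lambda>z x. vec_of_ell1 z $ 1 *\<^sub>C S1 x + vec_of_ell1 z $ 2 *\<^sub>C S2 x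
                      + vec_of_ell1 z $ 3 *\<^sub>C S3 x)"
  shows "isometry_into_B S \<and>
    (\<exists>k\<ge>1. \<exists>v. induced_norms S k v \<noteq> MIN_norms k v) \<and>
    \<not> complete_isometry_into_B MIN_norms S"
proof -
  define rU :: "real^2^2" where "rU = vector [vector [1 / 2, sqrt 3 / 2], vector [sqrt 3 / 2, - 1 / 2]]"
  define rV :: "real^2^2" where "rV = vector [vector [1 / 2, - sqrt 3 / 2], vector [sqrt 3 / 2, 1 / 2]]"
  have I': "(mat 1 :: complex^2^2) = complexify (mat 1)"
    by (simp add: vec_eq_iff complexify_def mat_def)
  have U': "U = complexify rU" and V': "V = complexify rV"
    by (simp_all add: U V rU_def rV_def vec_eq_iff complexify_def forall_2)
  have oI: "orthogonal_matrix (mat 1 :: real^2^2)"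
    by (simp add: orthogonal_matrix_id)
  have oU: "orthogonal_matrix rU" and oV: "orthogonal_matrix rV"
    by (simp_all add: orthogonal_matrix rU_def rV_def vec_eq_iff forall_2 matrix_matrix_mult_def
        sum_2 transpose_def mat_def)
  note cmat = contraction_mat_op_orthogonal[OF oI, folded I']
    contraction_mat_op_orthogonal[OF oU, folded U'] contraction_mat_op_orthogonal[OF oV, folded V']
  have cD: "contraction D" using D(1,3) by (rule contraction_onorm)
  have cT: "contraction T1" "contraction T2" "contraction T3"
    unfolding T1 T2 T3 by (intro contraction_dsum_op cmat cD)+
  have cThat: "contraction That1" "contraction That2" "contraction That3"
    unfolding That1 That2 That3 by (intro contraction_tensor_op cT contraction_id)+
  have cS: "contraction S1" "contraction S2" "contraction S3"
    unfolding S1 S2 S3 by (intro contraction_dsum_op cmat cThat)+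
  note linS = bounded_clinear_simps[OF contraction_bounded[OF cS(1)]]
    bounded_clinear_simps[OF contraction_bounded[OF cS(2)]]
    bounded_clinear_simps[OF contraction_bounded[OF cS(3)]]

  have upper: "norm (S z x) \<le> norm z * norm x" for z x
  proof -
    let ?z = "\<lambda>i. vec_of_ell1 z $ i"
    have "norm (S z x) \<le> cmod (?z 1) * norm (S1 x) + cmod (?z 2) * norm (S2 x)
        + cmod (?z 3) * norm (S3 x)"
      unfolding S by (rule order_trans[OF norm_triangle_ineq])
        (auto intro: order_trans[OF norm_triangle_ineq] simp: norm_scaleC)
    also have "\<dots> \<le> cmod (?z 1) * norm x + cmod (?z 2) * norm x + cmod (?z 3) * norm x"
      by (intro add_mono mult_left_mono contraction_norm cS) auto
    finally show ?thesis by (simp add: norm_ell1_def sum_3 algebra_simps)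
  qed
  have bS: "bounded_clinear (S z)" for z
    by (rule bounded_clinearI[where K = "norm z"])
      (auto simp: upper, auto intro!: ell2_eqI simp: S linS algebra_simps)
  have linear: "linear_into_B S"
    unfolding linear_into_B_def
    by (auto simp: bS, auto intro!: ell2_eqI simp: S plus_ell1_def scaleC_ell1_def algebra_simps)

  obtain d where d: "\<And>x i. coord (D x) i = d i * coord x i"
    using D(2) by (auto simp: diagonal_op_def)
  have eigen: "S z (ket (Inl (Inr a, Inr b, Inr c)))
      = (vec_of_ell1 z $ 1 * d a + vec_of_ell1 z $ 2 * d b + vec_of_ell1 z $ 3 * d c)
        *\<^sub>C ket (Inl (Inr a, Inr b, Inr c))" for z a b c
  proof -
    note m0 = bounded_clinear_simps(3)[OF contraction_bounded[OF cmat(1)]]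
      bounded_clinear_simps(3)[OF contraction_bounded[OF cmat(2)]]
      bounded_clinear_simps(3)[OF contraction_bounded[OF cmat(3)]]
    have Dk: "D (ket i) = d i *\<^sub>C ket i" for i
      by (rule ell2_eqI) (simp add: d)
    have T: "T1 (ket (Inr i)) = d i *\<^sub>C ket (Inr i)" "T2 (ket (Inr i)) = d i *\<^sub>C ket (Inr i)"
      "T3 (ket (Inr i)) = d i *\<^sub>C ket (Inr i)" for i
      unfolding T1 T2 T3 dsum_vec_ket(2)[symmetric] dsum_op_vec m0 Dk dsum_vec_linear by simp_all
    note bid = contraction_bounded[OF contraction_id]
    note bT = cT[THEN contraction_bounded]
    note bti = bounded_clinear_tensor_op[OF bid bid] bounded_clinear_tensor_op[OF bT(2) bid]
      bounded_clinear_tensor_op[OF bid bT(3)]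
    have "That1 (ket (Inr a, Inr b, Inr c)) = d a *\<^sub>C ket (Inr a, Inr b, Inr c)"
      "That2 (ket (Inr a, Inr b, Inr c)) = d b *\<^sub>C ket (Inr a, Inr b, Inr c)"
      "That3 (ket (Inr a, Inr b, Inr c)) = d c *\<^sub>C ket (Inr a, Inr b, Inr c)"
      unfolding That1 That2 That3 tensor_vec_ket[symmetric]
      by (simp_all add: tensor_op_vec bid bT bti T tensor_vec_scaleC)
    then have "S1 (ket (Inl (Inr a, Inr b, Inr c))) = d a *\<^sub>C ket (Inl (Inr a, Inr b, Inr c))"
      "S2 (ket (Inl (Inr a, Inr b, Inr c))) = d b *\<^sub>C ket (Inl (Inr a, Inr b, Inr c))"
      "S3 (ket (Inl (Inr a, Inr b, Inr c))) = d c *\<^sub>C ket (Inl (Inr a, Inr b, Inr c))"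
      unfolding S1 S2 S3 dsum_vec_ket(1)[symmetric] dsum_op_vec m0
      by (auto simp: dsum_vec_linear intro!: arg_cong2[where f = dsum_vec] ell2_eqI)
    then show ?thesis by (simp add: S scaleC_scaleC scaleC_add_left)
  qed
  have lower: "norm z \<le> onorm (S z)" for z
  proof -
    let ?z = "\<lambda>i. vec_of_ell1 z $ i"
    have "norm z \<le> onorm (S z) + e * norm z" if e: "e > 0" for e
    proof -
      obtain a b c where abc: "cmod (?z 1 * d a - of_real (cmod (?z 1))) \<le> e * cmod (?z 1)"
        "cmod (?z 2 * d b - of_real (cmod (?z 2))) \<le> e * cmod (?z 2)"
        "cmod (?z 3 * d c - of_real (cmod (?z 3))) \<le> e * cmod (?z 3)"
        using diagonal_phase_approx[OF d D(4) e] by meson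
      define w where "w = ?z 1 * d a + ?z 2 * d b + ?z 3 * d c"
      have w: "cmod w \<le> onorm (S z)"
        using onorm[of "S z" "ket (Inl (Inr a, Inr b, Inr c))"] bS[of z]
        by (simp add: eigen norm_scaleC w_def bounded_clinear_def)
      have nz: "norm z = cmod (?z 1) + cmod (?z 2) + cmod (?z 3)"
        by (simp add: norm_ell1_def sum_3)
      have "cmod (w - of_real (norm z)) = cmod ((?z 1 * d a - of_real (cmod (?z 1)))
          + (?z 2 * d b - of_real (cmod (?z 2))) + (?z 3 * d c - of_real (cmod (?z 3))))"
        by (simp add: w_def nz algebra_simps)
      also have "\<dots> \<le> e * norm z"
        unfolding nz distrib_left
        by (intro order_trans[OF norm_triangle_ineq] add_mono abc)
      finally have "cmod (of_real (norm z) - w) \<le> e * norm z"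
        by (simp add: norm_minus_commute)
      moreover have "cmod (of_real (norm z)) \<le> cmod w + cmod (of_real (norm z) - w)"
        by (rule norm_triangle_sub)
      ultimately show ?thesis using w by simp
    qed
    note eps = this
    show ?thesis
    proof (cases "norm z = 0")
      case True
      then show ?thesis using eps[of 1] by simp
    next
      case False
      show ?thesis
      proof (rule field_le_epsilon)
        fix r :: real assume "r > 0"
        then show "norm z \<le> onorm (S z) + r"
          using eps[of "r / norm z"] False by simp
      qed
    qed
  qed
  have "isometry_into_B S"
    unfolding isometry_into_B_def
  proof (intro conjI allI linear antisym lower)
    show "onorm (S z) \<le> norm z" for z
      by (rule onorm_bound) (use upper in auto)
  qed

  \<comment> \<open>block matrices have rows \<open>0, 1\<close>, whereas \<open>U\<close> and \<open>V\<close> have rows \<open>1, 2\<close>\<close>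
  define idx :: "nat \<Rightarrow> 2" where "idx i = (if i = 0 then 1 else 2)" for i
  define v :: "nat \<Rightarrow> nat \<Rightarrow> 3 ell1" where
    "v i j = Ell1 (vector [mat 1 $ idx i $ idx j, U $ idx i $ idx j, V $ idx i $ idx j])" for i j
  have sum_idx: "(\<Sum>j<2. f (idx j)) = (\<Sum>j\<in>UNIV. f j)" for f :: "2 \<Rightarrow> 'b::comm_monoid_add"
    by (simp add: sum_2 idx_def numeral_2_eq_2)

  have "MIN_norms 2 v \<le> sqrt 8"
  proof (rule MIN_norms_le)
    fix g :: "3 ell1 \<Rightarrow> complex"
    assume g: "bounded_clinear g" and le: "\<And>z. cmod (g z) \<le> norm z"
    define p q r where pqr: "p = g (Ell1 (axis 1 1))" "q = g (Ell1 (axis 2 1))" "r = g (Ell1 (axis 3 1))"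
    have le1: "cmod p \<le> 1" "cmod q \<le> 1" "cmod r \<le> 1"
      unfolding pqr using le norm_ell1_axis by metis+
    have gv: "g (v i j) = mat 1 $ idx i $ idx j * p + U $ idx i $ idx j * q + V $ idx i $ idx j * r"
      for i j
      by (subst ell1_3_functional[OF g]) (simp add: v_def pqr)
    \<comment> \<open>\<open>U\<close> is orthogonal to \<open>1\<close> and to \<open>V\<close> for the trace inner product, and \<open>tr V = 1\<close>\<close>
    have "(\<Sum>i<2. \<Sum>j<2. (cmod (g (v i j)))\<^sup>2)
        = 2 * (cmod p)\<^sup>2 + 2 * (cmod q)\<^sup>2 + 2 * (cmod r)\<^sup>2 + 2 * Re (p * cnj r)"
    proof -
      let ?s = "complex_of_real (sqrt 3 / 2)"
      have s: "(cmod (?s * x))\<^sup>2 = 3 / 4 * (cmod x)\<^sup>2" for x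
        by (simp add: norm_mult norm_divide power_mult_distrib power_divide)
      have "(\<Sum>i<2. \<Sum>j<2. (cmod (g (v i j)))\<^sup>2)
          = (cmod (p + (q + r) / 2))\<^sup>2 + (cmod (?s * (q - r)))\<^sup>2
            + ((cmod (?s * (q + r)))\<^sup>2 + (cmod (p + (r - q) / 2))\<^sup>2)"
      proof -
        have gs: "g (v 0 0) = p + (q + r) / 2" "g (v 0 1) = ?s * (q - r)"
          "g (v 1 0) = ?s * (q + r)" "g (v 1 1) = p + (r - q) / 2"
          by (simp_all add: gv idx_def U V mat_def field_simps)
        have "(\<Sum>i<2. \<Sum>j<2. f i j) = f 0 0 + f 0 1 + (f 1 0 + f 1 1)"
          for f :: "nat \<Rightarrow> nat \<Rightarrow> real"
          by (simp add: numeral_2_eq_2)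
        then show ?thesis by (simp only: gs)
      qed
      also have "\<dots> = 2 * (cmod p)\<^sup>2 + 2 * (cmod q)\<^sup>2 + 2 * (cmod r)\<^sup>2 + 2 * Re (p * cnj r)"
        unfolding s cmod_power2 by (simp add: power2_eq_square field_simps)
      finally show ?thesis .
    qed
    also have "\<dots> \<le> 2 * 1 + 2 * 1 + 2 * 1 + 2 * 1"
    proof -
      have "Re (p * cnj r) \<le> cmod p * cmod r"
        using complex_Re_le_cmod[of "p * cnj r"] by (simp add: norm_mult)
      also have "\<dots> \<le> 1" using le1 by (simp add: mult_le_one)
      finally show ?thesis
        using le1 by (intro add_mono mult_left_mono) (auto simp: power_le_one)
    qed
    finally show "(\<Sum>i<2. \<Sum>j<2. (cmod (g (v i j)))\<^sup>2) \<le> 8" by simp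
  qed
  moreover have "3 \<le> induced_norms S 2 v"
  proof -
    \<comment> \<open>the normalised maximally entangled vector of \<open>\<complex>\<^sup>2 \<otimes> \<complex>\<^sup>2\<close>, as a pair of vectors of the last
      summand \<open>\<complex>\<^sup>2\<close>\<close>
    define x :: "nat \<Rightarrow> ((2 + int) \<times> (2 + int) \<times> (2 + int) + 2) ell2" where
      "x j = complex_of_real (1 / sqrt 2) *\<^sub>C ket (Inr (idx j))" for j
    have nx: "norm (x j) = 1 / sqrt 2" for j by (simp add: x_def norm_scaleC norm_divide)
    have That0: "That1 0 = 0" "That2 0 = 0" "That3 0 = 0"
      using cThat[THEN contraction_bounded] by (simp_all add: bounded_clinear_simps)
    have Sk: "S z (ket (Inr j)) = dsum_vec 0 (vec_of_ell1 z $ 1 *\<^sub>C mat_op (mat 1) (ket j)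
        + vec_of_ell1 z $ 2 *\<^sub>C mat_op U (ket j) + vec_of_ell1 z $ 3 *\<^sub>C mat_op V (ket j))" for z j
      unfolding S S1 S2 S3 dsum_vec_ket(2)[symmetric] dsum_op_vec That0 dsum_vec_linear
      by (auto intro!: arg_cong2[where f = dsum_vec] ell2_eqI)
    have entangled: "(\<Sum>j<2. S (v i j) (ket (Inr (idx j)))) = 3 *\<^sub>C ket (Inr (idx i))" for i
    proof -
      let ?f = "\<lambda>M j. M $ idx i $ j *\<^sub>C mat_op M (ket j)"
      have "(\<Sum>j<2. S (v i j) (ket (Inr (idx j))))
          = (\<Sum>j<2. dsum_vec 0 (?f (mat 1) (idx j) + ?f U (idx j) + ?f V (idx j)))"
        by (rule sum.cong) (simp_all add: Sk v_def)
      also have "\<dots> = dsum_vec 0 (\<Sum>j\<in>UNIV. ?f (mat 1) j + ?f U j + ?f V j)"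
        by (subst sum_idx) (rule dsum_vec_sum)
      also have "(\<Sum>j\<in>UNIV. ?f (mat 1) j + ?f U j + ?f V j) = ket (idx i) + ket (idx i) + ket (idx i)"
        using orthogonal_fixes_entangled[OF oI, folded I', of "idx i"]
          orthogonal_fixes_entangled[OF oU, folded U', of "idx i"]
          orthogonal_fixes_entangled[OF oV, folded V', of "idx i"]
        by (simp add: sum.distrib)
      also have "dsum_vec 0 \<dots> = 3 *\<^sub>C ket (Inr (idx i))"
        by (rule ell2_eqI) (simp add: coord_dsum_vec split: sum.split)
      finally show ?thesis .
    qed
    have "(\<Sum>j<2. S (v i j) (x j)) = (3 :: complex) *\<^sub>C x i" for i
    proof -
      have "(\<Sum>j<2. S (v i j) (x j))
          = complex_of_real (1 / sqrt 2) *\<^sub>C (\<Sum>j<2. S (v i j) (ket (Inr (idx j))))"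
        unfolding x_def bounded_clinear_simps(2)[OF bS] numeral_2_eq_2
        by (simp add: scaleC_add_right)
      then show ?thesis unfolding entangled by (simp add: x_def scaleC_scaleC mult.commute)
    qed
    then have "L2_set (\<lambda>i. norm (\<Sum>j<2. S (v i j) (x j))) {..<2} = 3"
      by (simp add: norm_scaleC nx L2_set_def power_divide power_mult_distrib)
    moreover have "L2_set (\<lambda>j. norm (x j)) {..<2} \<le> 1"
      by (simp add: nx L2_set_def power_divide)
    ultimately show ?thesis
      using block_norm_ge[of "\<lambda>i j. S (v i j)" x 2] bS by (simp add: induced_norms_def)
  qed
  moreover have "sqrt 8 < (3::real)" by (rule real_less_lsqrt) auto
  ultimately have ne: "induced_norms S 2 v \<noteq> MIN_norms 2 v" by linarith
  then have "\<exists>k\<ge>1. \<exists>v. induced_norms S k v \<noteq> MIN_norms k v"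
    by (intro exI[of _ 2]) auto
  then show ?thesis
    using \<open>isometry_into_B S\<close> by (auto simp: complete_isometry_into_B_def induced_norms_def)
qed

end
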